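(* In the setting of the context (in particular $\mu(\tau>t)\sim\mathcal L(t)/t^\alpha$ with $0<\alpha<1$ and $\mathcal L$ slowly varying), suppose that the sets $\{\tau\circ f^j>t\}$ are quasi-independent in the sense that there is a constant $K$ such that for all $t>0$ and all $j_1\ne j_2$, $$\mu\big(\tau(f^{j_1}x)>t,\ \tau(f^{j_2}x)>t\big)\le K\,\mu\big(\tau(f^{j_1}x)>t\big)\,\mu\big(\tau(f^{j_2}x)>t\big).$$ Then there is a constant $D$ such that for all sufficiently large $t$ and all positive integers $k<\mathcal N(t)$, $$\mu(\tau_k(x)>t)\le\frac{D\,k\,\mathcal L(t)}{t^\alpha}.$$ In fact $$\lim_{k\to\infty,\ k/\mathcal N(t)\to0}\frac{t^\alpha}{k\,\mathcal L(t)}\,\mu(\tau_k(x)>t)=1 .$$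
   Context: A function $\mathcal L:\mathbb R^+\to\mathbb R^+$ is slowly varying if $\lim_{t\to\infty}\mathcal L(ht)/\mathcal L(t)=1$ for every $h>0$; a function is regularly varying of index $\gamma$ if it is $t^\gamma$ times a slowly varying function. Setting. $f:X\to X$ preserves a probability measure $\mu$. $\tau:X\to(0,\infty)$ is measurable with $\mu(\tau>t)\sim\mathcal L(t)/t^\alpha$ as $t\to\infty$, where $0<\alpha<1$ and $\mathcal L$ is slowly varying. $\tau_k(x)=\sum_{i=0}^{k-1}\tau(f^ix)$. $\mathcal R$ is a regularly varying, eventually monotone positive function of index $1/\alpha$ with $\lim_{t\to\infty} t\,\mathcal L(\mathcal R(t))/\mathcal R(t)^\alpha=1$. $\mathcal N(t)$ is the smallest positive integer such that $\mathcal R(\mathcal N(t))\ge t$ (so $\mathcal N(t)\sim t^\alpha/\mathcal L(t)$). The limit in the last display means: for every $\eta>0$ there are $k_0$ and $\delta>0$ such that the quantity is within $\eta$ of $1$ whenever $k\ge k_0$ and $k/\mathcal N(t)\le\delta$. *)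

theory Defs
  imports "HOL-Probability.Probability"
begin

text \<open>Functions on the positive reals are total functions on \<^typ>\<open>real\<close> whose values
  at nonpositive arguments are irrelevant.\<close>

definition slowly_varying :: "(real \<Rightarrow> real) \<Rightarrow> bool" where
  "slowly_varying L \<longleftrightarrow>
     (\<forall>t>0. L t > 0) \<and> (\<forall>h>0. ((\<lambda>t. L (h * t) / L t) \<longlongrightarrow> 1) at_top)"

definition regularly_varying :: "real \<Rightarrow> (real \<Rightarrow> real) \<Rightarrow> bool" where
  "regularly_varying \<gamma> R \<longleftrightarrow>
     (\<exists>L. slowly_varying L \<and> (\<forall>t>0. R t = t powr \<gamma> * L t))"

definition eventually_monotone :: "(real \<Rightarrow> real) \<Rightarrow> bool" where
  "eventually_monotone R \<longleftrightarrow> (\<exists>T. mono_on {T..} R \<or> antimono_on {T..} R)"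

definition measure_preserving_map :: "'a measure \<Rightarrow> ('a \<Rightarrow> 'a) \<Rightarrow> bool" where
  "measure_preserving_map M f \<longleftrightarrow> f \<in> M \<rightarrow>\<^sub>M M \<and> distr M M f = M"

definition birkhoff_sum :: "('a \<Rightarrow> 'a) \<Rightarrow> ('a \<Rightarrow> real) \<Rightarrow> nat \<Rightarrow> 'a \<Rightarrow> real" where
  "birkhoff_sum f \<tau> k x = (\<Sum>i<k. \<tau> ((f ^^ i) x))"

text \<open>If \<open>R\<close> is unbounded along the positive integers, as it is when it is regularly varying
  of positive index and eventually monotone, the set of admissible \<open>n\<close> is nonempty and the
  least element is attained.\<close>

definition first_level :: "(real \<Rightarrow> real) \<Rightarrow> real \<Rightarrow> nat" where
  "first_level R t = (LEAST n. 0 < n \<and> R (real n) \<ge> t)"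

definition quasi_independent :: "'a measure \<Rightarrow> ('a \<Rightarrow> 'a) \<Rightarrow> ('a \<Rightarrow> real) \<Rightarrow> bool" where
  "quasi_independent M f \<tau> \<longleftrightarrow>
     (\<exists>K. \<forall>t>0. \<forall>j1 j2. j1 \<noteq> j2 \<longrightarrow>
        measure M {x \<in> space M. \<tau> ((f ^^ j1) x) > t \<and> \<tau> ((f ^^ j2) x) > t}
        \<le> K * measure M {x \<in> space M. \<tau> ((f ^^ j1) x) > t}
            * measure M {x \<in> space M. \<tau> ((f ^^ j2) x) > t})"

end

theory Submission
  imports Defs
begin

text \<open>Write \<open>F\<close> for the tail of \<open>\<tau>\<close>. Since \<open>F\<close> is regularly varying of index \<open>-\<alpha> > -1\<close>, the mean of
  \<open>\<tau>\<close> truncated at \<open>s\<close> is at most \<open>C s F(s)\<close>, so Markov's inequality controls the contribution of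
  the small summands. Cutting each summand at \<open>t\<close> gives the bound with the constant \<open>D\<close>.
  For the limit, a Birkhoff sum exceeds \<open>t\<close> only if one summand exceeds \<open>(1 - \<epsilon>) t\<close>, or two
  exceed \<open>\<beta> t\<close>, or the summands below \<open>\<beta> t\<close> add up to more than \<open>\<epsilon> t\<close>. The first event
  has the main contribution \<open>k F(t)\<close>, the second is negligible by quasi-independence, and the
  third is small when \<open>\<beta>\<close> is small compared with \<open>\<epsilon>\<close>. Conversely, quasi-independence
  and Bonferroni's inequality show that some summand exceeds \<open>t\<close> with probability close
  to \<open>k F(t)\<close>.\<close>

section \<open>Regular variation\<close>

text \<open>The quotient of \<open>F\<close> by \<open>L t / t powr \<alpha>\<close> tends to 1 both
  at \<open>t\<close> and at \<open>c * t\<close>. Slow variation disposes of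
  \<open>L (c * t) / L t\<close>, and the powers leave \<open>c powr - \<alpha>\<close>.\<close>

lemma slowly_varying_quotient_tendsto:
  fixes F L :: "real \<Rightarrow> real"
  assumes L: "slowly_varying L" and F: "F \<sim>[at_top] (\<lambda>t. L t / t powr \<alpha>)"
    and Fpos: "\<And>t. F t > 0" and c: "c > 0"
  shows "((\<lambda>t. F (c * t) / F t) \<longlongrightarrow> c powr - \<alpha>) at_top"
proof -
  have scale: "filterlim (\<lambda>t. c * t) at_top at_top"
    by (rule filterlim_tendsto_pos_mult_at_top[OF tendsto_const c filterlim_ident])
  have Q: "((\<lambda>t. F t / (L t / t powr \<alpha>)) \<longlongrightarrow> 1) at_top"
  proof (rule asymp_equivD_strong[OF F])
    show "\<forall>\<^sub>F t in at_top. F t \<noteq> 0 \<or> L t / t powr \<alpha> \<noteq> 0"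
      using Fpos by (auto simp: less_imp_neq[symmetric])
  qed
  have Qc: "((\<lambda>t. F (c * t) / (L (c * t) / (c * t) powr \<alpha>)) \<longlongrightarrow> 1) at_top"
    using filterlim_compose[OF Q scale] .
  have Lc: "((\<lambda>t. L (c * t) / L t) \<longlongrightarrow> 1) at_top"
    using L c by (simp add: slowly_varying_def)
  have "((\<lambda>t. F (c * t) / (L (c * t) / (c * t) powr \<alpha>) * (L (c * t) / L t)
            / (F t / (L t / t powr \<alpha>)) * c powr - \<alpha>) \<longlongrightarrow> 1 * 1 / 1 * c powr - \<alpha>) at_top"
    by (intro tendsto_intros Qc Lc Q) simp_all
  moreover have "\<forall>\<^sub>F t in at_top. F (c * t) / (L (c * t) / (c * t) powr \<alpha>) * (L (c * t) / L t)
            / (F t / (L t / t powr \<alpha>)) * c powr - \<alpha> = F (c * t) / F t"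
    using eventually_gt_at_top[of 0]
  proof eventually_elim
    case (elim t)
    have "L t > 0" "L (c * t) > 0" using L elim c by (auto simp: slowly_varying_def)
    moreover have "(c * t) powr \<alpha> = c powr \<alpha> * t powr \<alpha>" using elim c by (simp add: powr_mult)
    ultimately show ?case using elim c Fpos[of t]
      by (simp add: powr_minus field_simps)
  qed
  ultimately show ?thesis by (simp add: tendsto_cong)
qed

text \<open>Since \<open>R (2 * t) / R t\<close> tends to \<open>2 powr \<gamma>\<close>, which
  exceeds 1, \<open>R\<close> grows geometrically along a dyadic sequence. This rules out eventual
  decrease, and monotone increase carries the growth over to all large arguments.\<close>

lemma regularly_varying_at_top:
  assumes R: "regularly_varying \<gamma> R" and \<gamma>: "\<gamma> > 0" and mono: "eventually_monotone R"
  shows "filterlim R at_top at_top"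
proof -
  obtain l where l: "slowly_varying l" and Rl: "\<And>t. t > 0 \<Longrightarrow> R t = t powr \<gamma> * l t"
    using R by (auto simp: regularly_varying_def)
  have Rpos: "R t > 0" if "t > 0" for t using l Rl that by (auto simp: slowly_varying_def)
  have "((\<lambda>t. 2 powr \<gamma> * (l (2 * t) / l t)) \<longlongrightarrow> 2 powr \<gamma> * 1) at_top"
    using l by (intro tendsto_intros) (simp add: slowly_varying_def)
  moreover have one: "1 < 2 powr \<gamma>" using \<gamma> by simp
  \<comment> \<open>A factor strictly between 1 and the limit turns convergence into an inequality
    that can be iterated.\<close>
  then obtain b where b: "1 < b" "b < 2 powr \<gamma>" using dense by blast
  ultimately have "\<forall>\<^sub>F t in at_top. b < 2 powr \<gamma> * (l (2 * t) / l t)"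
    by (intro order_tendstoD(1)) auto
  with eventually_gt_at_top[of 0] have "\<forall>\<^sub>F t in at_top. b * R t \<le> R (2 * t)"
  proof eventually_elim
    case (elim t)
    have "l t > 0" using l elim by (simp add: slowly_varying_def)
    then have "b * l t \<le> 2 powr \<gamma> * l (2 * t)" using elim(2) by (simp add: field_simps)
    then have "b * l t * t powr \<gamma> \<le> 2 powr \<gamma> * l (2 * t) * t powr \<gamma>"
      by (rule mult_right_mono) simp
    then show ?case using elim by (simp add: Rl powr_mult mult_ac)
  qed
  then obtain T0 where T0: "\<And>t. t \<ge> T0 \<Longrightarrow> b * R t \<le> R (2 * t)"
    by (auto simp: eventually_at_top_linorder)
  obtain T1 where T1: "mono_on {T1..} R \<or> antimono_on {T1..} R"
    using mono by (auto simp: eventually_monotone_def)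
  define T where "T = Max {1, T0, T1}"
  have T: "T \<ge> 1" "T \<ge> T0" "T \<ge> T1" by (auto simp: T_def)
  have ge: "T \<le> 2 ^ n * T" for n :: nat
    using T mult_right_mono[of 1 "2 ^ n :: real" T] by simp
  have grow: "b ^ n * R T \<le> R (2 ^ n * T)" for n :: nat
  proof (induction n)
    case (Suc n)
    have "b * (b ^ n * R T) \<le> b * R (2 ^ n * T)" using Suc b by simp
    also have "\<dots> \<le> R (2 * (2 ^ n * T))" using ge[of n] T by (intro T0) linarith
    finally show ?case by (simp add: mult_ac)
  qed simp
  have unb: "\<exists>n. Z < R (2 ^ n * T)" for Z
  proof -
    obtain n where "Z / R T < b ^ n" using real_arch_pow b by blast
    then have "Z < b ^ n * R T" using Rpos[of T] T by (simp add: field_simps)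
    with grow[of n] show ?thesis by (meson less_le_trans)
  qed
  have "mono_on {T1..} R"
  proof (rule ccontr)
    assume "\<not> mono_on {T1..} R"
    then have "antimono_on {T1..} R" using T1 by blast
    moreover obtain n where "R T < R (2 ^ n * T)" using unb by blast
    ultimately show False
      using ge[of n] T monotone_onD[of "{T1..}" "(\<le>)" "(\<ge>)" R T "2 ^ n * T"] by auto
  qed
  then have mn: "R x \<le> R y" if "T \<le> x" "x \<le> y" for x y
    using that T monotone_onD[of "{T1..}" "(\<le>)" "(\<le>)" R x y] by simp
  show ?thesis
    unfolding filterlim_at_top eventually_at_top_linorder
  proof
    fix Z
    obtain n where "Z < R (2 ^ n * T)" using unb by blast
    then show "\<exists>N. \<forall>x\<ge>N. Z \<le> R x"
      using mn ge by (intro exI[of _ "2 ^ n * T"]) (meson less_le order_trans)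
  qed
qed

section \<open>Size of the first level\<close>

lemma first_level_pos:
  assumes "filterlim R at_top at_top"
  shows "0 < first_level R t"
proof -
  have "\<forall>\<^sub>F n in sequentially. t \<le> R (real n)"
    using filterlim_compose[OF assms filterlim_real_sequentially] by (simp add: filterlim_at_top)
  then have "\<forall>\<^sub>F n in sequentially. 0 < n \<and> t \<le> R (real n)"
    using eventually_gt_at_top[of 0] by eventually_elim simp
  then obtain n where "0 < n \<and> t \<le> R (real n)"
    by (auto simp: eventually_sequentially)
  from LeastI[of "\<lambda>n. 0 < n \<and> t \<le> R (real n)", OF this] show ?thesis
    by (simp add: first_level_def)
qed

lemma less_first_levelD:
  assumes "0 < m" "m < first_level R t"
  shows "R (real m) < t"
  using not_less_Least[of m "\<lambda>n. 0 < n \<and> t \<le> R (real n)"] assms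
  by (auto simp: first_level_def not_le)

text \<open>If \<open>T \<le> R (real n)\<close> with \<open>n\<close> positive, then for
  \<open>t < T\<close> the integer \<open>n\<close> is admissible, so the first level is at most
  \<open>n\<close>. The limit in the theorem ranges over all positive \<open>t\<close>, and this is
  how a large level forces a large \<open>t\<close>.\<close>

lemma first_level_large_imp:
  assumes "filterlim R at_top at_top"
  shows "\<exists>n. \<forall>t. n \<le> first_level R t \<longrightarrow> T \<le> t"
proof -
  have "\<forall>\<^sub>F n in sequentially. T \<le> R (real n)"
    using filterlim_compose[OF assms filterlim_real_sequentially] by (simp add: filterlim_at_top)
  then have "\<forall>\<^sub>F n in sequentially. 0 < n \<and> T \<le> R (real n)"
    using eventually_gt_at_top[of 0] by eventually_elim simp
  then obtain n where n: "0 < n" "T \<le> R (real n)"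
    by (auto simp: eventually_sequentially)
  have "T \<le> t" if "Suc n \<le> first_level R t" for t
    using less_first_levelD[of n R t] n that by auto
  then show ?thesis by blast
qed

text \<open>The relation between \<open>L\<close> and \<open>R\<close> makes
  \<open>s * F (R s)\<close> tend to 1. The integer just below the first level has
  \<open>R\<close>-value less than \<open>t\<close>, where \<open>F\<close> is at least
  \<open>F t\<close>. The bound converts smallness of \<open>k / first_level R t\<close> into
  smallness of \<open>k * F t\<close>.\<close>

lemma first_level_mult_tail_le:
  fixes F L R :: "real \<Rightarrow> real"
  assumes R: "filterlim R at_top at_top" and L: "\<And>t. t > 0 \<Longrightarrow> L t > 0"
    and F: "F \<sim>[at_top] (\<lambda>t. L t / t powr \<alpha>)" and Fpos: "\<And>t. F t > 0" and anti: "antimono F"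
    and RL: "((\<lambda>t. t * L (R t) / R t powr \<alpha>) \<longlongrightarrow> 1) at_top"
  shows "\<exists>n. \<forall>t. n \<le> first_level R t \<longrightarrow> real (first_level R t) * F t \<le> 4"
proof -
  have Q: "((\<lambda>t. F t / (L t / t powr \<alpha>)) \<longlongrightarrow> 1) at_top"
  proof (rule asymp_equivD_strong[OF F])
    show "\<forall>\<^sub>F t in at_top. F t \<noteq> 0 \<or> L t / t powr \<alpha> \<noteq> 0"
      using Fpos by (auto simp: less_imp_neq[symmetric])
  qed
  have "((\<lambda>t. F (R t) / (L (R t) / R t powr \<alpha>) * (t * L (R t) / R t powr \<alpha>)) \<longlongrightarrow> 1 * 1) at_top"
    by (intro tendsto_intros RL filterlim_compose[OF Q R])
  then have "\<forall>\<^sub>F t in at_top. F (R t) / (L (R t) / R t powr \<alpha>) * (t * L (R t) / R t powr \<alpha>) < 2"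
    by (rule order_tendstoD(2)) simp
  moreover have "\<forall>\<^sub>F t in at_top. R t > 0" using R by (simp add: filterlim_at_top_dense)
  ultimately have "\<forall>\<^sub>F t in at_top. t * F (R t) \<le> 2"
  proof eventually_elim
    case (elim t)
    then show ?case using L[of "R t"] by (simp add: field_simps)
  qed
  then have "\<forall>\<^sub>F n in sequentially. real n * F (R (real n)) \<le> 2"
    using filterlim_real_sequentially by (rule eventually_compose_filterlim)
  then obtain m where m: "\<And>n. n \<ge> m \<Longrightarrow> real n * F (R (real n)) \<le> 2"
    by (auto simp: eventually_sequentially)
  \<comment> \<open>The offset 2 makes the predecessor \<open>n\<close> of the level positive and at
    least \<open>m\<close>, so the level is at most \<open>2 * n\<close>. The limit 1, relaxed to 2,
    supplies the other factor of 4.\<close>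
  have "real (first_level R t) * F t \<le> 4" if "m + 2 \<le> first_level R t" for t
  proof -
    define n where "n = first_level R t - 1"
    have n: "0 < n" "n < first_level R t" "m \<le> n" "real (first_level R t) \<le> 2 * real n"
      using that by (auto simp: n_def)
    have "F t \<le> F (R (real n))"
      using less_first_levelD[OF n(1,2)] antimonoD[OF anti, of "R (real n)" t] by simp
    then have "real (first_level R t) * F t \<le> 2 * real n * F (R (real n))"
      using n(4) Fpos[of t] by (intro mult_mono) auto
    also have "\<dots> \<le> 4" using m[OF n(3)] by simp
    finally show ?thesis .
  qed
  then show ?thesis by blast
qed

section \<open>Probability estimates\<close>

text \<open>Induction on \<open>k\<close>: inclusion-exclusion for the new event and the union of
  the earlier ones, whose overlap is bounded by subadditivity.\<close>

lemma (in prob_space) bonferroni_lower: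
  fixes A :: "nat \<Rightarrow> 'a set"
  assumes A: "\<And>i. A i \<in> events"
  shows "(\<Sum>i<k. prob (A i)) - (\<Sum>i<k. \<Sum>j<i. prob (A i \<inter> A j)) \<le> prob (\<Union>i<k. A i)"
proof (induction k)
  case (Suc k)
  have "prob (\<Union>i<Suc k. A i) = prob (A k \<union> (\<Union>i<k. A i))" by (simp add: lessThan_Suc)
  also have "\<dots> = prob (A k) + prob (\<Union>i<k. A i) - prob (A k \<inter> (\<Union>i<k. A i))"
    by (rule measure_Un3) (use A in \<open>auto simp: fmeasurable_eq_sets\<close>)
  also have "prob (A k \<inter> (\<Union>i<k. A i)) = prob (\<Union>i<k. A k \<inter> A i)" by simp
  finally have eq: "prob (\<Union>i<Suc k. A i) = prob (A k) + prob (\<Union>i<k. A i) - prob (\<Union>i<k. A k \<inter> A i)" .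
  have "prob (\<Union>i<k. A k \<inter> A i) \<le> (\<Sum>i<k. prob (A k \<inter> A i))"
    by (rule finite_measure_subadditive_finite) (use A in auto)
  with eq Suc show ?case by simp
qed simp

text \<open>A term above \<open>s\<close>, if there is one, is unique. It is at most
  \<open>u\<close>, and all other terms survive the truncation.\<close>

lemma sum_le_one_large_plus_truncated:
  fixes a :: "nat \<Rightarrow> real"
  assumes small: "\<And>i. i < k \<Longrightarrow> a i \<le> u" and u: "0 \<le> u"
    and one: "\<And>i j. i < k \<Longrightarrow> j < k \<Longrightarrow> s < a i \<Longrightarrow> s < a j \<Longrightarrow> i = j"
    and nonneg: "\<And>i. i < k \<Longrightarrow> 0 \<le> a i"
  shows "(\<Sum>i<k. a i) \<le> u + (\<Sum>i<k. if a i \<le> s then a i else 0)"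
proof (cases "\<exists>m<k. s < a m")
  case True
  then obtain m where m: "m < k" "s < a m" by blast
  have "(\<Sum>i<k. a i) = a m + (\<Sum>i\<in>{..<k} - {m}. a i)" using m by (simp add: sum.remove)
  also have "(\<Sum>i\<in>{..<k} - {m}. a i) = (\<Sum>i\<in>{..<k} - {m}. if a i \<le> s then a i else 0)"
    using one m by (intro sum.cong) (auto simp: not_le)
  also have "\<dots> \<le> (\<Sum>i<k. if a i \<le> s then a i else 0)"
    using nonneg by (intro sum_mono2) auto
  finally show ?thesis using small m by fastforce
next
  case False
  then have "(\<Sum>i<k. a i) = (\<Sum>i<k. if a i \<le> s then a i else 0)"
    by (intro sum.cong) force+
  with u show ?thesis by simp
qed

section \<open>Stationarity along orbits and truncated means\<close>

locale stationary_observable = prob_space M for M :: "'a measure" +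
  fixes f :: "'a \<Rightarrow> 'a" and \<tau> :: "'a \<Rightarrow> real"
  assumes mpt: "measure_preserving_map M f"
    and meas [measurable]: "\<tau> \<in> borel_measurable M"
    and pos: "\<And>x. x \<in> space M \<Longrightarrow> \<tau> x > 0"
begin

definition tail :: "real \<Rightarrow> real" where
  "tail t = prob {x \<in> space M. \<tau> x > t}"

text \<open>Large values are discarded rather than capped, so that a truncated sum is exactly the
  contribution of the summands at most \<open>s\<close>.\<close>

definition truncated :: "real \<Rightarrow> 'a \<Rightarrow> real" where
  "truncated s x = (if \<tau> x \<le> s then \<tau> x else 0)"

lemma truncated_measurable [measurable]: "truncated s \<in> borel_measurable M"
  unfolding truncated_def by measurable

lemma truncated_nonneg: "x \<in> space M \<Longrightarrow> 0 \<le> truncated s x"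
  using pos by (auto simp: truncated_def less_imp_le)

lemma truncated_integrable: "integrable M (truncated s)"
  by (rule integrable_const_bound[where B = "\<bar>s\<bar>"])
     (auto simp: truncated_def dest: pos intro!: AE_I2)

lemma f_measurable [measurable]: "f \<in> M \<rightarrow>\<^sub>M M" 
  using mpt by (simp add: measure_preserving_map_def)

lemma iterate_measurable [measurable]: "(f ^^ i) \<in> M \<rightarrow>\<^sub>M M"
  by (induction i) (auto simp: id_def)

lemma distr_iterate: "distr M M (f ^^ i) = M"
proof (induction i)
  case 0
  then show ?case by (simp add: id_def distr_id)
next
  case (Suc i)
  have "distr M M (f ^^ Suc i) = distr (distr M M (f ^^ i)) M f"
    by (simp add: distr_distr)
  also have "\<dots> = M"
    using mpt unfolding Suc by (simp add: measure_preserving_map_def)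
  finally show ?case .
qed

lemma iterate_space: "x \<in> space M \<Longrightarrow> (f ^^ i) x \<in> space M"
  using measurable_space[OF iterate_measurable] .

lemma prob_iterate: "prob {x \<in> space M. \<tau> ((f ^^ i) x) > t} = tail t"
proof -
  have "tail t = measure (distr M M (f ^^ i)) {x \<in> space M. \<tau> x > t}"
    by (simp add: distr_iterate tail_def)
  also have "\<dots> = prob ((f ^^ i) -` {x \<in> space M. \<tau> x > t} \<inter> space M)"
    by (rule measure_distr) auto
  also have "(f ^^ i) -` {x \<in> space M. \<tau> x > t} \<inter> space M = {x \<in> space M. \<tau> ((f ^^ i) x) > t}"
    using iterate_space by auto
  finally show ?thesis ..
qed

lemma integrable_truncated_iterate: "integrable M (\<lambda>x. truncated s ((f ^^ i) x))"
  by (rule integrable_distr[OF iterate_measurable]) (simp add: distr_iterate truncated_integrable)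

lemma expectation_truncated_iterate:
  "expectation (\<lambda>x. truncated s ((f ^^ i) x)) = expectation (truncated s)"
  using integral_distr[of "f ^^ i" M M "truncated s"] by (simp add: distr_iterate)

lemma antimono_tail: "antimono tail"
  unfolding tail_def by (intro antimonoI finite_measure_mono) auto

lemma tail_nonneg: "0 \<le> tail t"
  by (simp add: tail_def)

lemma birkhoff_sum_measurable [measurable]: "birkhoff_sum f \<tau> k \<in> borel_measurable M"
  unfolding birkhoff_sum_def by measurable

text \<open>One halving step is \<open>E[\<tau>; \<tau> \<le> t] \<le> E[\<tau>; \<tau> \<le> t/2] + t F(t/2)\<close>; as \<open>F(t/2) \<le> r F(t)\<close> with
  \<open>r < 2\<close>, the bound \<open>C t F(t)\<close> reproduces itself once \<open>C \<ge> r / (1 - r/2)\<close>.\<close>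

lemma truncated_expectation_le:
  assumes T: "T > 0" and r: "0 \<le> r" "r < 2" and tp: "\<And>t. tail t > 0"
    and half: "\<And>t. t \<ge> T \<Longrightarrow> tail (t / 2) \<le> r * tail t"
  shows "\<exists>C>0. \<forall>t\<ge>T. expectation (truncated t) \<le> C * t * tail t"
proof -
  \<comment> \<open>The first entry serves the base range from \<open>T\<close> to
    \<open>2 * T\<close>, where the mean is at most \<open>t\<close> and the tail at least
    \<open>tail (2 * T)\<close>. The second serves the halving step.\<close>
  define C where "C = max (2 / tail (2 * T)) (r / (1 - r / 2))"
  have C0: "C > 0" using tp[of "2 * T"] by (auto simp: C_def less_max_iff_disj)
  have "r / (1 - r / 2) \<le> C" by (simp add: C_def)
  then have C1: "C * r / 2 + r \<le> C" using r by (simp add: field_simps)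
  have C2: "1 \<le> C * tail (2 * T)"
  proof -
    have "2 / tail (2 * T) \<le> C" by (simp add: C_def)
    then show ?thesis using tp[of "2 * T"] by (simp add: field_simps)
  qed
  have step: "expectation (truncated t) \<le> expectation (truncated (t / 2)) + t * tail (t / 2)"
    if "t > 0" for t
  proof -
    let ?A = "{x \<in> space M. \<tau> x > t / 2}"
    have "expectation (truncated t) \<le> expectation (\<lambda>x. truncated (t / 2) x + t * indicator ?A x)"
      using that
      by (intro integral_mono truncated_integrable Bochner_Integration.integrable_add
            integrable_mult_right integrable_real_indicator)
         (auto simp: truncated_def indicator_def emeasure_eq_measure)
    also have "\<dots> = expectation (truncated (t / 2)) + t * tail (t / 2)"
      by (simp add: truncated_integrable tail_def emeasure_eq_measure Bochner_Integration.integral_add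
          integrable_real_indicator)
    finally show ?thesis .
  qed
  \<comment> \<open>Induction over dyadic ranges: halving a \<open>t\<close> beyond the previous
    range lands inside it and stays above \<open>T\<close>.\<close>
  have "\<forall>t. T \<le> t \<and> t \<le> 2 ^ Suc n * T \<longrightarrow> expectation (truncated t) \<le> C * t * tail t" for n
  proof (induction n)
    case 0
    show ?case
    proof safe
      fix t assume t: "T \<le> t" "t \<le> 2 ^ Suc 0 * T"
      have "expectation (truncated t) \<le> expectation (\<lambda>_. t)"
        using t T by (intro integral_mono truncated_integrable) (auto simp: truncated_def)
      also have "\<dots> \<le> t * (C * tail (2 * T))" using C2 t T by (simp add: prob_space)
      also have "\<dots> \<le> t * (C * tail t)"
        using t T C0 antimonoD[OF antimono_tail, of t "2 * T"] by simp
      finally show "expectation (truncated t) \<le> C * t * tail t" by (simp add: mult_ac)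
    qed
  next
    case (Suc n)
    show ?case
    proof safe
      fix t assume t: "T \<le> t" "t \<le> 2 ^ Suc (Suc n) * T"
      show "expectation (truncated t) \<le> C * t * tail t"
      proof (cases "t \<le> 2 ^ Suc n * T")
        case True
        then show ?thesis using Suc t by blast
      next
        case False
        have "2 * T \<le> 2 ^ Suc n * T" using T by simp
        then have "T \<le> t / 2" "t / 2 \<le> 2 ^ Suc n * T" using False t by auto
        then have "expectation (truncated (t / 2)) \<le> C * (t / 2) * tail (t / 2)"
          using Suc by blast
        then have "expectation (truncated t) \<le> (C * t / 2 + t) * tail (t / 2)"
          using step[of t] t T by (simp add: algebra_simps)
        also have "\<dots> \<le> (C * t / 2 + t) * (r * tail t)"
          using half[of t] t T C0 by (intro mult_left_mono) auto
        also have "\<dots> = (C * r / 2 + r) * (t * tail t)" by (simp add: algebra_simps)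
        also have "\<dots> \<le> C * (t * tail t)"
          using C1 t T tp[of t] by (intro mult_right_mono) auto
        finally show ?thesis by (simp add: mult_ac)
      qed
    qed
  qed
  note all = this
  have "expectation (truncated t) \<le> C * t * tail t" if "T \<le> t" for t
  proof -
    obtain n where "t / T < 2 ^ n" using real_arch_pow[of 2 "t / T"] by auto
    then have "t \<le> 2 ^ Suc n * T" using T that by (simp add: field_simps)
    with all that show ?thesis by blast
  qed
  with C0 show ?thesis by blast
qed

section \<open>Upper and lower bounds for the tail of a Birkhoff sum\<close>

lemma prob_ex_gt_le: "prob {x \<in> space M. \<exists>i<k. \<tau> ((f ^^ i) x) > t} \<le> real k * tail t"
proof -
  have "prob (\<Union>i<k. {x \<in> space M. \<tau> ((f ^^ i) x) > t})
      \<le> (\<Sum>i<k. prob {x \<in> space M. \<tau> ((f ^^ i) x) > t})"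
    by (rule finite_measure_subadditive_finite) auto
  moreover have "(\<Union>i<k. {x \<in> space M. \<tau> ((f ^^ i) x) > t}) = {x \<in> space M. \<exists>i<k. \<tau> ((f ^^ i) x) > t}"
    by auto
  ultimately show ?thesis by (simp add: prob_iterate)
qed

text \<open>Markov's inequality; by stationarity all summands have the same mean.\<close>

lemma prob_truncated_sum_gt_le:
  assumes "u > 0"
  shows "prob {x \<in> space M. (\<Sum>i<k. truncated s ((f ^^ i) x)) > u}
      \<le> real k * expectation (truncated s) / u"
proof -
  have "prob {x \<in> space M. (\<Sum>i<k. truncated s ((f ^^ i) x)) > u}
      \<le> prob {x \<in> space M. (\<Sum>i<k. truncated s ((f ^^ i) x)) \<ge> u}"
    by (rule finite_measure_mono) auto
  also have "\<dots> \<le> expectation (\<lambda>x. \<Sum>i<k. truncated s ((f ^^ i) x)) / u"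
    using assms
    by (intro integral_Markov_inequality_measure[where A = "{}"])
       (auto intro!: AE_I2 sum_nonneg truncated_nonneg iterate_space integrable_truncated_iterate)
  also have "expectation (\<lambda>x. \<Sum>i<k. truncated s ((f ^^ i) x)) = real k * expectation (truncated s)"
    by (simp add: integrable_truncated_iterate expectation_truncated_iterate)
  finally show ?thesis .
qed

text \<open>When no summand exceeds \<open>t\<close>, the Birkhoff sum equals its truncation at
  \<open>t\<close>. The union bound accounts for the 1 in the constant, Markov's inequality for the
  \<open>C\<close>.\<close>

lemma prob_birkhoff_sum_gt_le:
  assumes t: "t > 0" and E: "expectation (truncated t) \<le> C * t * tail t"
  shows "prob {x \<in> space M. birkhoff_sum f \<tau> k x > t} \<le> (1 + C) * real k * tail t"
proof -
  let ?A = "{x \<in> space M. \<exists>i<k. \<tau> ((f ^^ i) x) > t}"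
  let ?B = "{x \<in> space M. (\<Sum>i<k. truncated t ((f ^^ i) x)) > t}"
  have "{x \<in> space M. birkhoff_sum f \<tau> k x > t} \<subseteq> ?A \<union> ?B"
  proof
    fix x assume x: "x \<in> {x \<in> space M. birkhoff_sum f \<tau> k x > t}"
    have eq: "birkhoff_sum f \<tau> k x = (\<Sum>i<k. truncated t ((f ^^ i) x))" if "x \<notin> ?A"
    proof -
      have "\<tau> ((f ^^ i) x) \<le> t" if "i < k" for i
        by (rule ccontr) (use \<open>x \<notin> ?A\<close> x that in auto)
      then show ?thesis by (simp add: birkhoff_sum_def truncated_def)
    qed
    show "x \<in> ?A \<union> ?B"
    proof (cases "x \<in> ?A")
      case False
      have "t < birkhoff_sum f \<tau> k x" using x by simp
      then have "x \<in> ?B" using x unfolding eq[OF False] by simp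
      then show ?thesis ..
    qed blast
  qed
  then have "prob {x \<in> space M. birkhoff_sum f \<tau> k x > t} \<le> prob (?A \<union> ?B)"
    by (intro finite_measure_mono) auto
  also have "\<dots> \<le> prob ?A + prob ?B" by (rule measure_Un_le) auto
  also have "\<dots> \<le> real k * tail t + real k * expectation (truncated t) / t"
    by (intro add_mono prob_ex_gt_le prob_truncated_sum_gt_le t)
  also have "real k * expectation (truncated t) / t \<le> real k * (C * t * tail t) / t"
    using E t by (intro divide_right_mono mult_left_mono) auto
  also have "\<dots> = C * real k * tail t" using t by simp
  finally show ?thesis by (simp add: algebra_simps)
qed

text \<open>Union bound over the ordered pairs of distinct indices, of which there are at most
  \<open>k ^ 2\<close>.\<close>

lemma prob_pair_gt_le:
  assumes qi: "\<And>i j. i \<noteq> j \<Longrightarrow>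
      prob {x \<in> space M. \<tau> ((f ^^ i) x) > s \<and> \<tau> ((f ^^ j) x) > s} \<le> K * tail s ^ 2"
    and K: "K \<ge> 0"
  shows "prob {x \<in> space M. \<exists>i<k. \<exists>j<k. i \<noteq> j \<and> \<tau> ((f ^^ i) x) > s \<and> \<tau> ((f ^^ j) x) > s}
      \<le> K * (real k * tail s) ^ 2"
proof -
  let ?P = "\<lambda>i j. {x \<in> space M. \<tau> ((f ^^ i) x) > s \<and> \<tau> ((f ^^ j) x) > s}"
  let ?I = "({..<k} \<times> {..<k}) \<inter> {p. fst p \<noteq> snd p}"
  have "prob (\<Union>p\<in>?I. ?P (fst p) (snd p)) \<le> (\<Sum>p\<in>?I. prob (?P (fst p) (snd p)))"
    by (rule finite_measure_subadditive_finite) auto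
  also have "\<dots> \<le> (\<Sum>p\<in>?I. K * tail s ^ 2)"
    by (intro sum_mono qi) auto
  also have "\<dots> \<le> (\<Sum>p\<in>{..<k} \<times> {..<k}. K * tail s ^ 2)"
    using K by (intro sum_mono2) auto
  also have "\<dots> = K * (real k * tail s) ^ 2"
    by (simp add: card_cartesian_product power2_eq_square)
  also have "(\<Union>p\<in>?I. ?P (fst p) (snd p))
      = {x \<in> space M. \<exists>i<k. \<exists>j<k. i \<noteq> j \<and> \<tau> ((f ^^ i) x) > s \<and> \<tau> ((f ^^ j) x) > s}"
    by force
  finally show ?thesis .
qed

text \<open>Outside the three events at most one summand exceeds \<open>s\<close>, it is at most
  \<open>(1 - \<epsilon>) * t\<close>, and the rest add up to at most \<open>\<epsilon> * t\<close>.
  The cutoff \<open>s\<close> stays free here and is later a small multiple of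
  \<open>t\<close>.\<close>

lemma prob_birkhoff_sum_gt_le_split:
  assumes t: "t > 0" and e: "0 < \<epsilon>" "\<epsilon> \<le> 1"
    and qi: "\<And>i j. i \<noteq> j \<Longrightarrow>
      prob {x \<in> space M. \<tau> ((f ^^ i) x) > s \<and> \<tau> ((f ^^ j) x) > s} \<le> K * tail s ^ 2"
    and K: "K \<ge> 0"
  shows "prob {x \<in> space M. birkhoff_sum f \<tau> k x > t}
      \<le> real k * tail ((1 - \<epsilon>) * t) + K * (real k * tail s) ^ 2
        + real k * expectation (truncated s) / (\<epsilon> * t)"
proof -
  let ?A = "{x \<in> space M. \<exists>i<k. \<tau> ((f ^^ i) x) > (1 - \<epsilon>) * t}"
  let ?B = "{x \<in> space M. \<exists>i<k. \<exists>j<k. i \<noteq> j \<and> \<tau> ((f ^^ i) x) > s \<and> \<tau> ((f ^^ j) x) > s}"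
  let ?C = "{x \<in> space M. (\<Sum>i<k. truncated s ((f ^^ i) x)) > \<epsilon> * t}"
  have "{x \<in> space M. birkhoff_sum f \<tau> k x > t} \<subseteq> (?A \<union> ?B) \<union> ?C"
  proof (rule subsetI, rule ccontr)
    fix x assume x: "x \<in> {x \<in> space M. birkhoff_sum f \<tau> k x > t}" and n: "x \<notin> (?A \<union> ?B) \<union> ?C"
    have "(\<Sum>i<k. \<tau> ((f ^^ i) x))
        \<le> (1 - \<epsilon>) * t + (\<Sum>i<k. if \<tau> ((f ^^ i) x) \<le> s then \<tau> ((f ^^ i) x) else 0)"
    proof (rule sum_le_one_large_plus_truncated)
      show "0 \<le> (1 - \<epsilon>) * t" using e t by simp
      show "\<tau> ((f ^^ i) x) \<le> (1 - \<epsilon>) * t" if "i < k" for i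
        by (rule ccontr) (use n x that in auto)
      show "i = j" if "i < k" "j < k" "s < \<tau> ((f ^^ i) x)" "s < \<tau> ((f ^^ j) x)" for i j
        using n x that by auto
      show "0 \<le> \<tau> ((f ^^ i) x)" for i
        using x pos[OF iterate_space] by (auto simp: less_imp_le)
    qed
    moreover have "(\<Sum>i<k. if \<tau> ((f ^^ i) x) \<le> s then \<tau> ((f ^^ i) x) else 0) \<le> \<epsilon> * t"
      using n x by (auto simp: truncated_def not_less)
    ultimately show False using x by (auto simp: birkhoff_sum_def algebra_simps)
  qed
  then have "prob {x \<in> space M. birkhoff_sum f \<tau> k x > t} \<le> prob ((?A \<union> ?B) \<union> ?C)"
    by (intro finite_measure_mono) auto
  also have "\<dots> \<le> prob (?A \<union> ?B) + prob ?C" by (rule measure_Un_le) auto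
  also have "prob (?A \<union> ?B) \<le> prob ?A + prob ?B" by (rule measure_Un_le) auto
  also have "prob ?A + prob ?B + prob ?C \<le> real k * tail ((1 - \<epsilon>) * t) + K * (real k * tail s) ^ 2
        + real k * expectation (truncated s) / (\<epsilon> * t)"
    using t e by (intro add_mono prob_ex_gt_le prob_pair_gt_le prob_truncated_sum_gt_le qi K) auto
  finally show ?thesis by simp
qed

text \<open>As \<open>\<tau>\<close> is positive, one summand above \<open>t\<close> suffices.
  Bonferroni's inequality loses at most \<open>k ^ 2\<close> pair probabilities.\<close>

lemma prob_birkhoff_sum_gt_ge:
  assumes qi: "\<And>i j. i \<noteq> j \<Longrightarrow>
      prob {x \<in> space M. \<tau> ((f ^^ i) x) > t \<and> \<tau> ((f ^^ j) x) > t} \<le> K * tail t ^ 2"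
    and K: "K \<ge> 0"
  shows "real k * tail t - K * (real k * tail t) ^ 2 \<le> prob {x \<in> space M. birkhoff_sum f \<tau> k x > t}"
proof -
  let ?A = "\<lambda>i. {x \<in> space M. \<tau> ((f ^^ i) x) > t}"
  have "(\<Sum>i<k. \<Sum>j<i. prob (?A i \<inter> ?A j)) \<le> (\<Sum>i<k. \<Sum>j<k. K * tail t ^ 2)"
  proof (rule sum_mono)
    fix i assume i: "i \<in> {..<k}"
    have "(\<Sum>j<i. prob (?A i \<inter> ?A j)) \<le> (\<Sum>j<i. K * tail t ^ 2)"
    proof (rule sum_mono)
      fix j assume "j \<in> {..<i}"
      moreover have "?A i \<inter> ?A j = {x \<in> space M. \<tau> ((f ^^ i) x) > t \<and> \<tau> ((f ^^ j) x) > t}" by auto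
      ultimately show "prob (?A i \<inter> ?A j) \<le> K * tail t ^ 2" using qi[of i j] by auto
    qed
    also have "\<dots> \<le> (\<Sum>j<k. K * tail t ^ 2)" using i K by (intro sum_mono2) auto
    finally show "(\<Sum>j<i. prob (?A i \<inter> ?A j)) \<le> (\<Sum>j<k. K * tail t ^ 2)" .
  qed
  also have "\<dots> = K * (real k * tail t) ^ 2" by (simp add: power2_eq_square)
  finally have "real k * tail t - K * (real k * tail t) ^ 2 \<le> prob (\<Union>i<k. ?A i)"
    using bonferroni_lower[of ?A k] by (simp add: prob_iterate)
  also have "\<dots> \<le> prob {x \<in> space M. birkhoff_sum f \<tau> k x > t}"
  proof (rule finite_measure_mono)
    show "(\<Union>i<k. ?A i) \<subseteq> {x \<in> space M. birkhoff_sum f \<tau> k x > t}"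
    proof
      fix x assume "x \<in> (\<Union>i<k. ?A i)"
      then obtain i where i: "i < k" "x \<in> space M" "\<tau> ((f ^^ i) x) > t" by auto
      have "\<tau> ((f ^^ i) x) \<le> (\<Sum>i<k. \<tau> ((f ^^ i) x))"
        using i pos iterate_space by (intro member_le_sum) (auto simp: less_imp_le)
      with i show "x \<in> {x \<in> space M. birkhoff_sum f \<tau> k x > t}" by (simp add: birkhoff_sum_def)
    qed
  qed auto
  finally show ?thesis .
qed

text \<open>The constants are chosen in the order \<open>\<epsilon>\<close>, \<open>\<beta>\<close>,
  \<open>\<delta>\<close>: the first makes \<open>(1 - \<epsilon>) powr - \<alpha>\<close> close to
  1, the second makes the truncated part small relative to \<open>\<epsilon>\<close>, and the third
  makes the quadratic pair terms negligible against \<open>real k * tail t\<close>.\<close>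

lemma birkhoff_sum_tail_ratio:
  assumes \<alpha>: "\<alpha> < 1" and tp: "\<And>t. tail t > 0"
    and rv: "\<And>c. c > 0 \<Longrightarrow> ((\<lambda>t. tail (c * t) / tail t) \<longlongrightarrow> c powr - \<alpha>) at_top"
    and qi: "\<And>s i j. s > 0 \<Longrightarrow> i \<noteq> j \<Longrightarrow>
      prob {x \<in> space M. \<tau> ((f ^^ i) x) > s \<and> \<tau> ((f ^^ j) x) > s} \<le> K * tail s ^ 2"
    and K: "K \<ge> 0"
    and E: "\<And>t. t \<ge> T \<Longrightarrow> expectation (truncated t) \<le> C * t * tail t" and C: "C > 0"
    and \<kappa>: "\<kappa> > 0"
  shows "\<exists>\<delta>>0. \<exists>T'. \<forall>t\<ge>T'. \<forall>k>0. real k * tail t \<le> \<delta> \<longrightarrow>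
      \<bar>prob {x \<in> space M. birkhoff_sum f \<tau> k x > t} / (real k * tail t) - 1\<bar> \<le> \<kappa>"
proof -
  \<comment> \<open>Each of the three terms of the upper bound may contribute a relative error
    \<open>h\<close>.\<close>
  define h where "h = \<kappa> / 3"
  have h: "h > 0" using \<kappa> by (simp add: h_def)
  have "((\<lambda>\<epsilon>. (1 - \<epsilon>) powr - \<alpha>) \<longlongrightarrow> (1 - 0) powr - \<alpha>) (at_right 0)"
    by (intro tendsto_intros) auto
  then have "\<forall>\<^sub>F \<epsilon> in at_right 0. (1 - \<epsilon>) powr - \<alpha> < 1 + h"
    using h by (intro order_tendstoD(2)) auto
  moreover have "\<forall>\<^sub>F \<epsilon> in at_right 0. 0 < \<epsilon> \<and> \<epsilon> < (1::real)"
    by (auto simp: eventually_at_right_field intro: exI[of _ 1])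
  ultimately have "\<forall>\<^sub>F \<epsilon> in at_right 0. (0 < \<epsilon> \<and> \<epsilon> < 1) \<and> (1 - \<epsilon>) powr - \<alpha> < 1 + h"
    by eventually_elim auto
  from eventually_happens'[OF _ this]
  obtain \<epsilon> where e: "0 < \<epsilon>" "\<epsilon> < 1" "(1 - \<epsilon>) powr - \<alpha> < 1 + h"
    by auto
  \<comment> \<open>Twice the limit of \<open>tail (\<beta> * t) / tail t\<close>, hence an upper
    bound of this quotient for large \<open>t\<close>.\<close>
  define B where "B \<beta> = 2 * \<beta> powr - \<alpha>" for \<beta> :: real
  \<comment> \<open>Relative to the main term the truncated part will cost
    \<open>2 * C / \<epsilon> * \<beta> powr (1 - \<alpha>)\<close>, which vanishes with
    \<open>\<beta>\<close> because the exponent is positive.\<close>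
  have "((\<lambda>\<beta>. \<beta> powr (1 - \<alpha>)) \<longlongrightarrow> 0 powr (1 - \<alpha>)) (at_right 0)"
    using \<alpha> by (intro tendsto_powr') (auto intro!: eventually_at_right_less tendsto_intros
        simp: eventually_at_right_field intro: exI[of _ 1])
  then have "((\<lambda>\<beta>. 2 * C / \<epsilon> * \<beta> powr (1 - \<alpha>)) \<longlongrightarrow> 2 * C / \<epsilon> * 0 powr (1 - \<alpha>)) (at_right 0)"
    by (rule tendsto_mult_left)
  then have "\<forall>\<^sub>F \<beta> in at_right 0. 2 * C / \<epsilon> * \<beta> powr (1 - \<alpha>) < h"
    using h by (intro order_tendstoD(2)) auto
  moreover have "\<forall>\<^sub>F \<beta> in at_right 0. 0 < (\<beta>::real)" by (rule eventually_at_right_less)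
  ultimately have "\<forall>\<^sub>F \<beta> in at_right 0. 0 < \<beta> \<and> 2 * C / \<epsilon> * \<beta> powr (1 - \<alpha>) < h"
    by eventually_elim auto
  from eventually_happens'[OF _ this]
  obtain \<beta> where b: "0 < \<beta>" "2 * C / \<epsilon> * \<beta> powr (1 - \<alpha>) < h"
    by auto
  have Bpos: "B \<beta> > 0" using b by (simp add: B_def)
  have CB: "C * \<beta> * B \<beta> / \<epsilon> \<le> h"
  proof -
    have "\<beta> powr (1 - \<alpha>) = \<beta> * \<beta> powr - \<alpha>" using b by (simp add: powr_add[symmetric] powr_mult_base)
    with b show ?thesis by (simp add: B_def mult_ac)
  qed
  have "\<forall>\<^sub>F t in at_top. tail ((1 - \<epsilon>) * t) / tail t < 1 + h"
    using rv[of "1 - \<epsilon>"] e by (intro order_tendstoD(2)) auto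
  moreover have "\<forall>\<^sub>F t in at_top. tail (\<beta> * t) / tail t < B \<beta>"
    using rv[of \<beta>] b by (intro order_tendstoD(2)) (auto simp: B_def)
  \<comment> \<open>The threshold \<open>T / \<beta>\<close> makes the bound on truncated means
    available at \<open>\<beta> * t\<close>.\<close>
  moreover have "\<forall>\<^sub>F t in at_top. 0 < t \<and> T / \<beta> \<le> t"
    using eventually_gt_at_top[of 0] eventually_ge_at_top[of "T / \<beta>"] by eventually_elim auto
  ultimately have "\<forall>\<^sub>F t in at_top. (0 < t \<and> T \<le> \<beta> * t) \<and>
      tail ((1 - \<epsilon>) * t) \<le> (1 + h) * tail t \<and> tail (\<beta> * t) \<le> B \<beta> * tail t"
  proof eventually_elim
    case (elim t)
    then show ?case using b tp[of t] by (auto simp: field_simps)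
  qed
  then obtain T' where T': "\<And>t. t \<ge> T' \<Longrightarrow> (0 < t \<and> T \<le> \<beta> * t) \<and>
      tail ((1 - \<epsilon>) * t) \<le> (1 + h) * tail t \<and> tail (\<beta> * t) \<le> B \<beta> * tail t"
    by (auto simp: eventually_at_top_linorder)
  \<comment> \<open>The denominator is positive and dominates both \<open>K\<close> and
    \<open>K * (B \<beta>)\<^sup>2\<close>, so one \<open>\<delta>\<close> serves the lower and the
    upper bound.\<close>
  define \<delta> where "\<delta> = h / ((K + 1) * ((B \<beta>)\<^sup>2 + 1))"
  have d: "\<delta> > 0" using h K by (auto simp: \<delta>_def intro!: divide_pos_pos mult_pos_pos add_nonneg_pos)
  have d1: "K * (B \<beta>)\<^sup>2 * \<delta> \<le> h" "K * \<delta> \<le> h"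
  proof -
    have den: "(K + 1) * ((B \<beta>)\<^sup>2 + 1) > 0"
      using K by (intro mult_pos_pos add_nonneg_pos) auto
    have *: "h = (K + 1) * ((B \<beta>)\<^sup>2 + 1) * \<delta>" unfolding \<delta>_def using den by auto
    have "K * (B \<beta>)\<^sup>2 \<le> (K + 1) * ((B \<beta>)\<^sup>2 + 1)" using K by (intro mult_mono) auto
    then show "K * (B \<beta>)\<^sup>2 * \<delta> \<le> h" using d by (subst *) (rule mult_right_mono, auto)
    have "K * 1 \<le> (K + 1) * ((B \<beta>)\<^sup>2 + 1)" using K by (intro mult_mono) auto
    then show "K * \<delta> \<le> h" using d by (subst *) (rule mult_right_mono, auto)
  qed
  have "\<bar>prob {x \<in> space M. birkhoff_sum f \<tau> k x > t} / (real k * tail t) - 1\<bar> \<le> \<kappa>"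
    if t: "t \<ge> T'" and k: "k > 0" and kd: "real k * tail t \<le> \<delta>" for t k
  proof -
    let ?p = "prob {x \<in> space M. birkhoff_sum f \<tau> k x > t}"
    define y where "y = real k * tail t"
    have y: "0 < y" "y \<le> \<delta>" using k kd tp[of t] by (auto simp: y_def)
    have t0: "0 < t" "T \<le> \<beta> * t" and t1: "tail ((1 - \<epsilon>) * t) \<le> (1 + h) * tail t"
      and t2: "tail (\<beta> * t) \<le> B \<beta> * tail t" using T'[OF t] by auto
    have bt: "\<beta> * t > 0" using t0 b by simp
    \<comment> \<open>Trading one factor \<open>y\<close> for \<open>\<delta>\<close> makes the
      quadratic errors linear in \<open>y\<close>.\<close>
    have yy: "y\<^sup>2 \<le> \<delta> * y" using y by (simp add: power2_eq_square)
    have "y - K * y\<^sup>2 \<le> ?p"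
      unfolding y_def by (rule prob_birkhoff_sum_gt_ge[OF qi[OF t0(1)] K])
    moreover have "K * y\<^sup>2 \<le> h * y"
    proof -
      have "K * y\<^sup>2 \<le> K * (\<delta> * y)" using yy K by (rule mult_left_mono)
      also have "\<dots> = K * \<delta> * y" by simp
      also have "\<dots> \<le> h * y" using d1 y by (intro mult_right_mono) auto
      finally show ?thesis .
    qed
    moreover have "h * y \<le> \<kappa> * y" using y h by (simp add: h_def)
    ultimately have lower: "(1 - \<kappa>) * y \<le> ?p" by (simp add: algebra_simps)
    have "?p \<le> real k * tail ((1 - \<epsilon>) * t) + K * (real k * tail (\<beta> * t)) ^ 2
        + real k * expectation (truncated (\<beta> * t)) / (\<epsilon> * t)"
      using e by (intro prob_birkhoff_sum_gt_le_split t0 qi[OF bt] K) auto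
    moreover have "real k * tail ((1 - \<epsilon>) * t) \<le> (1 + h) * y"
      using mult_left_mono[OF t1, of "real k"] by (simp add: y_def mult_ac)
    moreover have kb: "real k * tail (\<beta> * t) \<le> B \<beta> * y"
      using mult_left_mono[OF t2, of "real k"] by (simp add: y_def mult_ac)
    have "K * (real k * tail (\<beta> * t)) ^ 2 \<le> h * y"
    proof -
      have "K * (real k * tail (\<beta> * t)) ^ 2 \<le> K * (B \<beta> * y) ^ 2"
        using kb K tail_nonneg by (intro mult_left_mono power_mono) auto
      also have "\<dots> = K * (B \<beta>)\<^sup>2 * y\<^sup>2" by (simp add: power_mult_distrib)
      also have "\<dots> \<le> K * (B \<beta>)\<^sup>2 * (\<delta> * y)" using yy K by (intro mult_left_mono) auto
      also have "\<dots> = (K * (B \<beta>)\<^sup>2 * \<delta>) * y" by simp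
      also have "\<dots> \<le> h * y" using d1 y by (intro mult_right_mono) auto
      finally show ?thesis .
    qed
    moreover have "real k * expectation (truncated (\<beta> * t)) / (\<epsilon> * t) \<le> h * y"
    proof -
      have "real k * expectation (truncated (\<beta> * t)) / (\<epsilon> * t)
          \<le> real k * (C * (\<beta> * t) * tail (\<beta> * t)) / (\<epsilon> * t)"
        using E[OF t0(2)] e t0 by (intro divide_right_mono mult_left_mono) auto
      also have "\<dots> = C * \<beta> / \<epsilon> * (real k * tail (\<beta> * t))" using t0 by simp
      also have "\<dots> \<le> C * \<beta> / \<epsilon> * (B \<beta> * y)"
        using kb C b e by (intro mult_left_mono) auto
      also have "\<dots> = C * \<beta> * B \<beta> / \<epsilon> * y" by simp
      also have "\<dots> \<le> h * y" using CB y by (intro mult_right_mono) auto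
      finally show ?thesis .
    qed
    ultimately have "?p \<le> (1 + h) * y + h * y + h * y" by linarith
    then have upper: "?p \<le> (1 + \<kappa>) * y" by (simp add: h_def algebra_simps)
    have "1 - \<kappa> \<le> ?p / y" "?p / y \<le> 1 + \<kappa>"
      using lower upper y by (auto simp: pos_le_divide_eq pos_divide_le_eq)
    then show ?thesis unfolding y_def by linarith
  qed
  with d show ?thesis by blast
qed

end

section \<open>Passage from the tail of \<open>\<tau>\<close> to \<open>L\<close> and the first
  level\<close>

theorem theorem3p2:
  fixes M :: "'a measure" and f :: "'a \<Rightarrow> 'a" and \<tau> :: "'a \<Rightarrow> real"
    and L R :: "real \<Rightarrow> real" and \<alpha> :: real
  assumes "prob_space M"
    and "measure_preserving_map M f"
    and "\<tau> \<in> borel_measurable M"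
    and "\<And>x. x \<in> space M \<Longrightarrow> \<tau> x > 0"
    and "0 < \<alpha>" and "\<alpha> < 1"
    and "slowly_varying L"
    and "(\<lambda>t. measure M {x \<in> space M. \<tau> x > t}) \<sim>[at_top] (\<lambda>t. L t / t powr \<alpha>)"
    and "regularly_varying (1 / \<alpha>) R"
    and "eventually_monotone R"
    and "((\<lambda>t. t * L (R t) / R t powr \<alpha>) \<longlongrightarrow> 1) at_top"
    and "quasi_independent M f \<tau>"
  shows "(\<exists>D. \<forall>\<^sub>F t in at_top. \<forall>k. 0 < k \<and> k < first_level R t \<longrightarrow>
            measure M {x \<in> space M. birkhoff_sum f \<tau> k x > t} \<le> D * real k * L t / t powr \<alpha>)
       \<and> (\<forall>\<eta>>0. \<exists>k0. \<exists>\<delta>>0. \<forall>t>0. \<forall>k\<ge>k0. real k / real (first_level R t) \<le> \<delta> \<longrightarrow>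
            \<bar>t powr \<alpha> / (real k * L t) * measure M {x \<in> space M. birkhoff_sum f \<tau> k x > t} - 1\<bar> \<le> \<eta>)"
proof -
  interpret stationary_observable M f \<tau>
    using assms by (intro stationary_observable.intro stationary_observable_axioms.intro) auto
  have Lpos: "L t > 0" if "t > 0" for t using assms(7) that by (simp add: slowly_varying_def)
  have F: "tail \<sim>[at_top] (\<lambda>t. L t / t powr \<alpha>)"
    using assms(8) by (simp add: tail_def[abs_def])
  have ev_pos: "\<forall>\<^sub>F t in at_top. 0 < L t / t powr \<alpha>"
    using eventually_gt_at_top[of 0] by eventually_elim (simp add: Lpos)
  have Q: "((\<lambda>t. tail t / (L t / t powr \<alpha>)) \<longlongrightarrow> 1) at_top"
    by (rule asymp_equivD_strong[OF F]) (use ev_pos in \<open>auto elim: eventually_mono\<close>)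
  \<comment> \<open>The asymptotics give positivity far out, and monotonicity of the tail carries it
    back to every \<open>t\<close>.\<close>
  have tp: "tail t > 0" for t
  proof -
    have "\<forall>\<^sub>F s in at_top. 0 < tail s / (L s / s powr \<alpha>)"
      using Q by (rule order_tendstoD(1)) simp
    with ev_pos eventually_ge_at_top[of t]
    have "\<forall>\<^sub>F s in at_top. t \<le> s \<and> 0 < tail s"
      by eventually_elim (metis less_asym zero_less_divide_iff)
    then obtain s where "t \<le> s" "0 < tail s" by (auto simp: eventually_at_top_linorder)
    with antimonoD[OF antimono_tail, of t s] show ?thesis by simp
  qed
  have rv: "((\<lambda>t. tail (c * t) / tail t) \<longlongrightarrow> c powr - \<alpha>) at_top" if "c > 0" for c
    using slowly_varying_quotient_tendsto[OF assms(7) F tp that] .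
  \<comment> \<open>The limit of \<open>tail (t / 2) / tail t\<close> is
    \<open>2 powr \<alpha>\<close>. Since \<alpha> < 1, there is room for a ratio \<open>r\<close>
    below 2, as the halving argument requires.\<close>
  have "2 powr \<alpha> < 2" using assms(6) powr_less_mono[of \<alpha> 1 "2::real"] by simp
  then obtain r where r: "2 powr \<alpha> < r" "r < 2" using dense by blast
  have r0: "0 \<le> r" using r by (smt (verit) powr_ge_zero)
  have "(1 / 2 :: real) powr - \<alpha> = 2 powr \<alpha>" by (simp add: powr_divide powr_minus field_simps)
  then have "\<forall>\<^sub>F t in at_top. tail (1 / 2 * t) / tail t < r"
    using rv[of "1 / 2"] r by (intro order_tendstoD(2)) auto
  with eventually_gt_at_top[of 0] have "\<forall>\<^sub>F t in at_top. 0 < t \<and> tail (t / 2) \<le> r * tail t"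
  proof eventually_elim
    case (elim t)
    then show ?case using tp[of t] by (simp add: field_simps)
  qed
  then obtain T where T: "\<And>t. t \<ge> T \<Longrightarrow> 0 < t \<and> tail (t / 2) \<le> r * tail t"
    by (auto simp: eventually_at_top_linorder)
  obtain C where C: "C > 0" "\<And>t. t \<ge> T \<Longrightarrow> expectation (truncated t) \<le> C * t * tail t"
    using truncated_expectation_le[of T r] T r r0 tp by blast
  obtain K0 where K0: "\<And>s i j. s > 0 \<Longrightarrow> i \<noteq> j \<Longrightarrow>
      prob {x \<in> space M. \<tau> ((f ^^ i) x) > s \<and> \<tau> ((f ^^ j) x) > s} \<le> K0 * tail s * tail s"
    using assms(12) unfolding quasi_independent_def prob_iterate by blast
  \<comment> \<open>The constant in the hypothesis has no prescribed sign, while the estimates above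
    use a nonnegative one.\<close>
  define K where "K = max K0 0"
  have qi: "prob {x \<in> space M. \<tau> ((f ^^ i) x) > s \<and> \<tau> ((f ^^ j) x) > s} \<le> K * tail s ^ 2"
    if "s > 0" "i \<noteq> j" for s i j
  proof -
    have "K0 * tail s * tail s \<le> K * tail s * tail s"
      using tail_nonneg[of s] by (intro mult_right_mono) (auto simp: K_def)
    with K0[OF that] show ?thesis by (simp add: power2_eq_square mult.assoc)
  qed
  have K: "K \<ge> 0" by (simp add: K_def)
  have Rtop: "filterlim R at_top at_top"
    using assms(5,9,10) by (intro regularly_varying_at_top[of "1 / \<alpha>"]) auto

  \<comment> \<open>The factor 2 in \<open>D\<close> pays for replacing \<open>tail t\<close> by
    \<open>L t / t powr \<alpha>\<close>.\<close>
  have "\<forall>\<^sub>F t in at_top. tail t / (L t / t powr \<alpha>) < 2"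
    using Q by (rule order_tendstoD(2)) simp
  with ev_pos eventually_ge_at_top[of T]
  have "\<forall>\<^sub>F t in at_top. \<forall>k. 0 < k \<and> k < first_level R t \<longrightarrow>
      prob {x \<in> space M. birkhoff_sum f \<tau> k x > t} \<le> ((1 + C) * 2) * real k * L t / t powr \<alpha>"
  proof eventually_elim
    case (elim t)
    have "tail t \<le> 2 * (L t / t powr \<alpha>)"
      using elim(3) unfolding pos_divide_less_eq[OF elim(1)] by (rule less_imp_le)
    then have le: "(1 + C) * real k * tail t \<le> (1 + C) * real k * (2 * (L t / t powr \<alpha>))" for k
      using C by (intro mult_left_mono) auto
    show ?case
    proof (intro allI impI)
      fix k
      have "prob {x \<in> space M. birkhoff_sum f \<tau> k x > t} \<le> (1 + C) * real k * tail t"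
        using prob_birkhoff_sum_gt_le[OF _ C(2)] T elim by blast
      also note le[of k]
      finally show "prob {x \<in> space M. birkhoff_sum f \<tau> k x > t} \<le> ((1 + C) * 2) * real k * L t / t powr \<alpha>"
        by (simp add: mult_ac)
    qed
  qed
  moreover have "\<exists>k0. \<exists>\<delta>>0. \<forall>t>0. \<forall>k\<ge>k0. real k / real (first_level R t) \<le> \<delta> \<longrightarrow>
      \<bar>t powr \<alpha> / (real k * L t) * prob {x \<in> space M. birkhoff_sum f \<tau> k x > t} - 1\<bar> \<le> \<eta>"
    if \<eta>: "\<eta> > 0" for \<eta>
  proof -
    \<comment> \<open>Two factors within \<open>\<kappa>\<close> of 1 have a product within
      \<open>\<kappa>\<^sup>2 + 2 * \<kappa>\<close> of 1, which is at most
      \<open>3 * \<kappa>\<close> when \<kappa> \<le> 1.\<close>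
    define \<kappa> where "\<kappa> = min 1 (\<eta> / 3)"
    have \<kappa>: "\<kappa> > 0" "\<kappa> \<le> 1" "3 * \<kappa> \<le> \<eta>" using \<eta> by (auto simp: \<kappa>_def)
    have "\<exists>d>0. \<exists>T'. \<forall>t\<ge>T'. \<forall>k>0. real k * tail t \<le> d \<longrightarrow>
        \<bar>prob {x \<in> space M. birkhoff_sum f \<tau> k x > t} / (real k * tail t) - 1\<bar> \<le> \<kappa>"
      by (rule birkhoff_sum_tail_ratio[where K = K and T = T and C = C and \<alpha> = \<alpha>];
          fact assms(6) tp rv qi K C \<kappa>(1))
    then obtain d T1 where d: "d > 0" and T1: "\<And>t k. t \<ge> T1 \<Longrightarrow> k > 0 \<Longrightarrow> real k * tail t \<le> d \<Longrightarrow>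
        \<bar>prob {x \<in> space M. birkhoff_sum f \<tau> k x > t} / (real k * tail t) - 1\<bar> \<le> \<kappa>"
      by blast
    have "\<forall>\<^sub>F t in at_top. dist (tail t / (L t / t powr \<alpha>)) 1 < \<kappa>"
      using Q \<kappa> by (intro tendstoD)
    then obtain T2 where T2: "\<And>t. t \<ge> T2 \<Longrightarrow> \<bar>tail t / (L t / t powr \<alpha>) - 1\<bar> \<le> \<kappa>"
      by (auto simp: eventually_at_top_linorder dist_real_def intro: less_imp_le)
    obtain n1 where n1: "\<And>t. n1 \<le> first_level R t \<Longrightarrow> max T1 T2 \<le> t"
      using first_level_large_imp[OF Rtop] by blast
    obtain n2 where n2: "\<And>t. n2 \<le> first_level R t \<Longrightarrow> real (first_level R t) * tail t \<le> 4"
      using first_level_mult_tail_le[OF Rtop Lpos F tp antimono_tail assms(11)] by blast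
    define n where "n = n1 + n2 + 1"
    \<comment> \<open>The entry \<open>d / 4\<close> makes \<open>real k * tail t\<close> at most
      \<open>d\<close>. The entry \<open>1 / real n\<close> forces the level to be at least
      \<open>n\<close> as soon as \<open>k\<close> is positive, which also makes \<open>t\<close>
      large; hence \<open>k0 = 1\<close> suffices below.\<close>
    define \<delta> where "\<delta> = min (d / 4) (1 / real n)"
    have \<delta>: "\<delta> > 0" "\<delta> \<le> d / 4" "\<delta> \<le> 1 / real n" using d by (auto simp: \<delta>_def n_def)
    have "\<bar>t powr \<alpha> / (real k * L t) * prob {x \<in> space M. birkhoff_sum f \<tau> k x > t} - 1\<bar> \<le> \<eta>"
      if t: "t > 0" and k: "k \<ge> 1" and kN: "real k / real (first_level R t) \<le> \<delta>" for t k
    proof -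
      let ?N = "first_level R t"
      have N: "0 < ?N" by (rule first_level_pos[OF Rtop])
      have kd: "real k \<le> \<delta> * real ?N" using kN N by (simp add: field_simps)
      have "1 \<le> 1 / real n * real ?N"
        using k kd mult_right_mono[OF \<delta>(3), of "real ?N"] by simp
      then have "real n \<le> real ?N" by (simp add: n_def field_simps)
      then have nN: "n1 \<le> ?N" "n2 \<le> ?N" by (auto simp: n_def)
      have "real k * tail t \<le> \<delta> * real ?N * tail t"
        using kd tp[of t] by (intro mult_right_mono) auto
      also have "\<dots> \<le> \<delta> * 4" using n2[OF nN(2)] \<delta> by (simp add: mult.assoc)
      also have "\<dots> \<le> d" using \<delta> by simp
      finally have kt: "real k * tail t \<le> d" .
      define a where "a = prob {x \<in> space M. birkhoff_sum f \<tau> k x > t} / (real k * tail t)"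
      define b where "b = tail t / (L t / t powr \<alpha>)"
      have a: "\<bar>a - 1\<bar> \<le> \<kappa>" unfolding a_def using n1[OF nN(1)] k kt by (intro T1) auto
      have b: "\<bar>b - 1\<bar> \<le> \<kappa>" unfolding b_def using n1[OF nN(1)] by (intro T2) auto
      have "t powr \<alpha> / (real k * L t) * prob {x \<in> space M. birkhoff_sum f \<tau> k x > t} = a * b"
        using tp[of t] Lpos[OF t] t k by (simp add: a_def b_def field_simps)
      also have "a * b - 1 = (a - 1) * (b - 1) + (a - 1) + (b - 1)" by (simp add: algebra_simps)
      also have "\<bar>\<dots>\<bar> \<le> \<bar>a - 1\<bar> * \<bar>b - 1\<bar> + \<bar>a - 1\<bar> + \<bar>b - 1\<bar>"
        unfolding abs_mult[symmetric] by linarith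
      also have "\<dots> \<le> \<kappa> * 1 + \<kappa> + \<kappa>"
        using a b \<kappa> by (intro add_mono mult_mono) auto
      also have "\<dots> \<le> \<eta>" using \<kappa> by simp
      finally show ?thesis .
    qed
    with \<delta>(1) show ?thesis by (intro exI[of _ 1] exI[of _ \<delta>]) simp
  qed
  ultimately show ?thesis by (intro conjI exI[of _ "(1 + C) * 2"]) simp_all
qed

end
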